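(* Let $\mathbb F$ be a finite field, $N\in\mathbb N$ and $i_1,\dots,i_N\ge0$ with $i_1+\dots+i_N=1$. Then $\dim\mathrm{Bad}_{\mathbb F((X^{-1}))}(i_1,\dots,i_N)=N$.
   Context: Let $\mathbb F$ have $h$ elements. $\mathbb F((X^{-1}))=\{\sum_{i=-n}^{\infty}a_{-i}X^{-i}: n\in\mathbb Z, a_i\in\mathbb F, a_n\ne0\}\cup\{0\}$ (formal Laurent series in $X^{-1}$), with absolute value $\|\sum_{i=-n}^\infty a_{-i}X^{-i}\|=h^n$ (for $a_n\neq0$) and $\|0\|=0$; $\mathbb F((X^{-1}))^N$ carries the metric $d(x,y)=\max_s\|x_s-y_s\|$ and $\dim$ is Hausdorff dimension with respect to it. $\mathbb F[X]$ is the polynomial ring. $\mathrm{Bad}_{\mathbb F((X^{-1}))}(i_1,\dots,i_N)$ is the set of $x=(x_1,\dots,x_N)\in\mathbb F((X^{-1}))^N$ for which there is $c(x)>0$ such that $\max\{\|qx_1-p_1\|^{1/i_1},\dots,\|qx_N-p_N\|^{1/i_N}\}\ge c(x)\|q\|^{-1}$ for all $q,p_1,\dots,p_N\in\mathbb F[X]$ with $q\ne0$, where terms with $i_s=0$ are omitted from the maximum. *)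

theory Defs
  imports "HOL-Analysis.Analysis" "HOL-Computational_Algebra.Formal_Laurent_Series"
begin

text \<open>F((X^-1)) is modelled as formal Laurent series 'a fls in the variable T = X^-1
  (finitely many negative powers of T, i.e. finitely many positive powers of X).
  The polynomial variable X is therefore fls_X_inv.\<close>

text \<open>Absolute value: for a nonzero series whose leading X-power is X^n
  (i.e. T-subdegree -n) the value is h^n with h = CARD('a); the value of 0 is 0.\<close>
definition lnorm :: "'a::{field,finite} fls \<Rightarrow> real" where
  "lnorm f = (if f = 0 then 0 else real CARD('a) powr (- real_of_int (fls_subdegree f)))"

definition poly_to_fls :: "'a::field poly \<Rightarrow> 'a fls" where
  "poly_to_fls p = poly (map_poly fls_const p) fls_X_inv"

definition lspace :: "nat \<Rightarrow> (nat \<Rightarrow> 'a::{field,finite} fls) set" where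
  "lspace N = {x. \<forall>s\<ge>N. x s = 0}"

definition ldist :: "nat \<Rightarrow> (nat \<Rightarrow> 'a::{field,finite} fls) \<Rightarrow> (nat \<Rightarrow> 'a fls) \<Rightarrow> real" where
  "ldist N x y = Max (insert 0 ((\<lambda>s. lnorm (x s - y s)) ` {..<N}))"

definition mdiam :: "('p \<Rightarrow> 'p \<Rightarrow> real) \<Rightarrow> 'p set \<Rightarrow> real" where
  "mdiam d U = (if U = {} then 0 else (SUP x\<in>U. SUP y\<in>U. d x y))"

definition mbounded :: "('p \<Rightarrow> 'p \<Rightarrow> real) \<Rightarrow> 'p set \<Rightarrow> bool" where
  "mbounded d U \<longleftrightarrow> (\<exists>B. \<forall>x\<in>U. \<forall>y\<in>U. d x y \<le> B)"

definition diam_pow :: "('p \<Rightarrow> 'p \<Rightarrow> real) \<Rightarrow> real \<Rightarrow> 'p set \<Rightarrow> real" where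
  "diam_pow d s U = (if U = {} then 0 else if s = 0 then 1 else mdiam d U powr s)"

definition hausdorff_content ::
  "('p \<Rightarrow> 'p \<Rightarrow> real) \<Rightarrow> 'p set \<Rightarrow> real \<Rightarrow> real \<Rightarrow> 'p set \<Rightarrow> ennreal" where
  "hausdorff_content d S s \<delta> E =
     (INF U \<in> {U :: nat \<Rightarrow> 'p set. E \<subseteq> (\<Union>j. U j) \<and>
                 (\<forall>j. U j \<subseteq> S \<and> mbounded d (U j) \<and> mdiam d (U j) \<le> \<delta>)}.
        (\<Sum>j. ennreal (diam_pow d s (U j))))"

definition hausdorff_measure ::
  "('p \<Rightarrow> 'p \<Rightarrow> real) \<Rightarrow> 'p set \<Rightarrow> real \<Rightarrow> 'p set \<Rightarrow> ennreal" where
  "hausdorff_measure d S s E = (SUP \<delta> \<in> {0<..}. hausdorff_content d S s \<delta> E)"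

definition hausdorff_dim :: "('p \<Rightarrow> 'p \<Rightarrow> real) \<Rightarrow> 'p set \<Rightarrow> 'p set \<Rightarrow> real" where
  "hausdorff_dim d S E = Inf {s. 0 \<le> s \<and> hausdorff_measure d S s E = 0}"

definition Bad :: "nat \<Rightarrow> (nat \<Rightarrow> real) \<Rightarrow> (nat \<Rightarrow> 'a::{field,finite} fls) set" where
  "Bad N i = {x \<in> lspace N. \<exists>c>0. \<forall>(q::'a poly) (p::nat \<Rightarrow> 'a poly). q \<noteq> 0 \<longrightarrow>
      Max ((\<lambda>s. lnorm (poly_to_fls q * x s - poly_to_fls (p s)) powr (1 / i s))
             ` {s. s < N \<and> i s \<noteq> 0})
        \<ge> c * inverse (lnorm (poly_to_fls q))}"

end

(* Coefficientwise, a box of side lengths h^(-(J+1)k - ceiling((J+1) k i_s)) around x is a node of level J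
   in a tree. By the pigeonhole principle some nontrivial linear form b + a_1 x_1 + ... + a_N x_N is so
   small that all rational points p/q with deg q < (J+1)k that approximate a point of the box well lie on
   one hyperplane. Those with deg q >= Jk can therefore only affect a neighbourhood of this hyperplane
   that is thin compared with the box, and so at most half of the subboxes of level J+1. A point that
   avoids the affected boxes at all levels is badly approximable. Halving at each level costs only a
   factor 2^J <= h^J, against boxes whose scale shrinks by h^k or more per level, so a cover of the
   remaining points has a sum of s-th powers of diameters bounded below whenever s <= N - 1/k. *)

theory Submission
  imports Defs
begin

text \<open>The length k of the degree windows balances two effects. Long windows make the factor 2
  lost per level cheap, since it lowers the exponent only by 1/k; but the constant c(x) obtained at
  the end gets worse as k grows. So k is fixed after the exponent s < N, and no single c(x) has to
  serve all s. The hypothesis i_1 + ... + i_N = 1 feeds the pigeonhole: with T = (J+1)k and side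
  exponents \<alpha>_s = ceiling(T i_s), the coefficients of the a_s number at least T, against T -
  1 conditions on the form. The boxes have different sides in different coordinates, whereas a
  covering set has a single diameter. Counting reconciles the two: a set of diameter at most h^(-t)
  fixes N t coefficients, so it meets at most a fraction h^(-N t) of the nodes at a level where all
  sides are at most h^(-t). Coordinates with i_s = 0 impose no condition and are left out of the
  linear forms, yet the tree still refines them (with \<alpha>_s = 0), so that the full dimension N
  is counted.\<close>

unbundle fps_syntax

section \<open>Small linear forms\<close>

text \<open>In terms of the absolute value: \<open>\<parallel>f\<parallel> \<le> h\<^sup>-\<^sup>m\<close>.\<close>
definition vanishes_below :: "int \<Rightarrow> 'a::zero fls \<Rightarrow> bool" where
  "vanishes_below m f \<longleftrightarrow> (\<forall>l<m. f $$ l = 0)"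

text \<open>The series variable is X^(-1), so the polynomials in X are the series without positive
  exponents. They play the role of the integers.\<close>

definition polynomial_fls :: "'a::zero fls \<Rightarrow> bool" where
  "polynomial_fls f \<longleftrightarrow> (\<forall>l>0. f $$ l = 0)"

lemma vanishes_below_iff_subdegree:
  "vanishes_below m f \<longleftrightarrow> f = 0 \<or> m \<le> fls_subdegree f"
  unfolding vanishes_below_def
  by (metis fls_eq0_below_subdegree fls_subdegree_geI fls_zero_nth order_less_le_trans)

lemma vanishes_below_mono: "vanishes_below m f \<Longrightarrow> n \<le> m \<Longrightarrow> vanishes_below n f"
  by (auto simp: vanishes_below_def)

lemma vanishes_below_add:
  "vanishes_below m f \<Longrightarrow> vanishes_below m g \<Longrightarrow> vanishes_below m (f + g)"
  for f g :: "'a::comm_ring_1 fls"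
  by (auto simp: vanishes_below_def)

lemma vanishes_below_diff:
  "vanishes_below m f \<Longrightarrow> vanishes_below m g \<Longrightarrow> vanishes_below m (f - g)"
  for f g :: "'a::comm_ring_1 fls"
  by (auto simp: vanishes_below_def)

lemma vanishes_below_sum:
  "(\<And>s. s \<in> S \<Longrightarrow> vanishes_below m (f s)) \<Longrightarrow> vanishes_below m (\<Sum>s\<in>S. f s)"
  for f :: "'b \<Rightarrow> 'a::comm_ring_1 fls"
  by (simp add: vanishes_below_def fls_nth_sum)

lemma vanishes_below_mult:
  "vanishes_below m f \<Longrightarrow> vanishes_below n g \<Longrightarrow> k \<le> m + n \<Longrightarrow> vanishes_below k (f * g)"
  for f g :: "'a::field fls"
  by (cases "f = 0 \<or> g = 0") (auto simp: vanishes_below_iff_subdegree)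

lemma vanishes_below_mult_cancel:
  "f \<noteq> 0 \<Longrightarrow> vanishes_below n (f * g) \<Longrightarrow> m + fls_subdegree f \<le> n \<Longrightarrow> vanishes_below m g"
  for f g :: "'a::field fls"
  by (cases "g = 0") (auto simp: vanishes_below_iff_subdegree)

lemma polynomial_fls_0: "polynomial_fls 0"
  by (simp add: polynomial_fls_def)

lemma polynomial_fls_add:
  "polynomial_fls f \<Longrightarrow> polynomial_fls g \<Longrightarrow> polynomial_fls (f + g)"
  for f g :: "'a::comm_ring_1 fls"
  by (auto simp: polynomial_fls_def)

lemma polynomial_fls_sum:
  "(\<And>s. s \<in> S \<Longrightarrow> polynomial_fls (f s)) \<Longrightarrow> polynomial_fls (\<Sum>s\<in>S. f s)"
  for f :: "'b \<Rightarrow> 'a::comm_ring_1 fls"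
  by (simp add: polynomial_fls_def fls_nth_sum)

lemma polynomial_fls_mult:
  fixes f g :: "'a::comm_ring_1 fls"
  assumes "polynomial_fls f" "polynomial_fls g"
  shows "polynomial_fls (f * g)"
  unfolding polynomial_fls_def
proof (intro allI impI)
  fix l :: int assume "l > 0"
  have "f $$ i * g $$ (l - i) = 0" for i
    using assms \<open>l > 0\<close> by (cases "i > 0") (auto simp: polynomial_fls_def)
  then show "(f * g) $$ l = 0"
    by (simp add: fls_times_nth(2))
qed

lemma polynomial_poly_to_fls: "polynomial_fls (poly_to_fls p)"
proof (induction p)
  case 0
  then show ?case by (simp add: poly_to_fls_def polynomial_fls_0)
next
  case (pCons a p)
  have "poly_to_fls (pCons a p) = fls_const a + fls_X_inv * poly_to_fls p"
    by (simp add: poly_to_fls_def map_poly_pCons)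
  moreover have "polynomial_fls (fls_const a)" "polynomial_fls (fls_X_inv :: 'a fls)"
    by (auto simp: polynomial_fls_def)
  ultimately show ?case
    using pCons.IH by (simp add: polynomial_fls_add polynomial_fls_mult)
qed

text \<open>The analogue of "an integer of modulus below 1 is 0". It turns an approximate relation
  into an exact one.\<close>

lemma polynomial_vanishes_below_1: "polynomial_fls f \<Longrightarrow> vanishes_below 1 f \<Longrightarrow> f = 0"
  by (intro fls_eqI) (metis fls_zero_nth linorder_not_less polynomial_fls_def
      vanishes_below_def zle_add1_eq_le add_0)

lemma polynomial_subdegree_le_0: "polynomial_fls f \<Longrightarrow> fls_subdegree f \<le> 0"
  by (cases "f = 0") (auto simp: polynomial_fls_def intro!: leI dest: nth_fls_subdegree_nonzero)

lemma ex_polynomial_part: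
  fixes f :: "'a::comm_ring_1 fls"
  shows "\<exists>b. polynomial_fls b \<and> vanishes_below 1 (b + f)"
proof -
  define b where "b = Abs_fls (\<lambda>l. if l \<le> 0 then - f $$ l else 0)"
  have b: "b $$ l = (if l \<le> 0 then - f $$ l else 0)" for l
    unfolding b_def
    by (rule nth_Abs_fls_lower_bound[of "min 0 (fls_subdegree f)"]) auto
  show ?thesis
    by (rule exI[of _ b]) (auto simp: polynomial_fls_def vanishes_below_def b)
qed

lemma card_field_ge_2: "2 \<le> CARD('a::{field,finite})"
proof -
  have "card {0, 1::'a} \<le> CARD('a)"
    by (intro card_mono) auto
  then show ?thesis by simp
qed

lemma lnorm_le_iff_vanishes_below:
  fixes f :: "'a::{field,finite} fls"
  shows "lnorm f \<le> real CARD('a) powr (- real_of_int m) \<longleftrightarrow> vanishes_below m f"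
  using card_field_ge_2[where 'a='a]
  by (auto simp: lnorm_def vanishes_below_iff_subdegree)

text \<open>Over a finite field counting replaces linear algebra: there are more vectors
  \<open>u\<close> than values of the \<open>M\<close> linear forms, so two vectors collide, and
  their difference solves the system.\<close>

lemma ex_nontrivial_relation:
  fixes w :: "'i \<Rightarrow> nat \<Rightarrow> 'a::{field,finite}"
  assumes fin: "finite I" and card: "M < card I"
  shows "\<exists>u. (\<exists>i\<in>I. u i \<noteq> 0) \<and> (\<forall>l<M. (\<Sum>i\<in>I. u i * w i l) = 0)"
proof -
  let ?A = "I \<rightarrow>\<^sub>E (UNIV :: 'a set)"
  let ?B = "{..<M} \<rightarrow>\<^sub>E (UNIV :: 'a set)"
  define \<Psi> where "\<Psi> u = (\<lambda>l\<in>{..<M}. \<Sum>i\<in>I. u i * w i l)" for u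
  have "card ?B < card ?A"
    using card fin card_field_ge_2[where 'a='a] by (simp add: card_PiE)
  moreover have "\<Psi> ` ?A \<subseteq> ?B" by (auto simp: \<Psi>_def PiE_def extensional_def)
  moreover have "finite ?B" by (auto intro: finite_PiE)
  ultimately have "\<not> inj_on \<Psi> ?A"
    by (metis card_inj_on_le leD)
  then obtain u v where uv: "u \<in> ?A" "v \<in> ?A" "u \<noteq> v" "\<Psi> u = \<Psi> v"
    by (auto simp: inj_on_def)
  then obtain i where i: "i \<in> I" "u i \<noteq> v i"
    by (metis PiE_ext)
  have "(\<Sum>i\<in>I. (u i - v i) * w i l) = 0" if "l < M" for l
    using fun_cong[OF uv(4), of l] that by (simp add: \<Psi>_def sum_subtractf left_diff_distrib)
  then show ?thesis
    using i by (intro exI[of _ "\<lambda>i. u i - v i"]) auto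
qed

text \<open>A pigeonhole form of Minkowski's linear forms theorem.\<close>
lemma ex_small_linear_form:
  fixes x :: "nat \<Rightarrow> 'a::{field,finite} fls"
  assumes fin: "finite S" and big: "M < (\<Sum>s\<in>S. \<alpha> s)"
  obtains a b where "polynomial_fls b" "\<And>s. polynomial_fls (a s)"
    "\<And>s. vanishes_below (1 - int (\<alpha> s)) (a s)"
    "\<exists>s\<in>S. a s \<noteq> 0" "vanishes_below (int M + 1) (b + (\<Sum>s\<in>S. a s * x s))"
proof -
  \<comment> \<open>The unknown \<open>u (s, j)\<close> will be the coefficient of X^j in
    \<open>a s\<close>. Equation \<open>l\<close> kills the coefficient of X^(-(l+1)) in the sum of
    the \<open>a s * x s\<close>; the nonnegative powers of X are left to \<open>b\<close>.\<close>
  let ?I = "Sigma S (\<lambda>s. {..<\<alpha> s})"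
  have finI: "finite ?I" and cardI: "M < card ?I"
    using fin big by auto
  obtain u where nz: "\<exists>i\<in>?I. u i \<noteq> 0"
    and rel: "\<forall>l<M. (\<Sum>i\<in>?I. u i * (case i of (s, j) \<Rightarrow> \<lambda>l. x s $$ (int l + 1 + int j)) l) = 0"
    using ex_nontrivial_relation[OF finI cardI, of "\<lambda>i l. (case i of (s, j) \<Rightarrow> \<lambda>l. x s $$ (int l + 1 + int j)) l"]
    by blast
  define a where "a s = (\<Sum>j<\<alpha> s. fls_const (u (s, j)) * fls_X_inv ^ j)" for s
  have a_nth: "a s $$ l = (\<Sum>j<\<alpha> s. if l = - int j then u (s, j) else 0)" for s l
    by (simp add: a_def fls_nth_sum if_distrib cong: if_cong)
  have pol: "polynomial_fls (a s)" for s
    by (auto simp: polynomial_fls_def a_nth)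
  have van: "vanishes_below (1 - int (\<alpha> s)) (a s)" for s
    unfolding vanishes_below_def a_nth by (intro allI impI sum.neutral) auto
  have anz: "\<exists>s\<in>S. a s \<noteq> 0"
  proof -
    from nz obtain s j where sj: "s \<in> S" "j < \<alpha> s" "u (s, j) \<noteq> 0" by auto
    have "a s $$ (- int j) = u (s, j)"
      using sj by (simp add: a_nth)
    then show ?thesis using sj by (metis fls_zero_nth)
  qed
  let ?F = "\<Sum>s\<in>S. a s * x s"
  have shift: "(fls_X_inv ^ j * x s) $$ l = x s $$ (l + int j)" for j s l
    by (simp add: fls_X_inv_power_times_conv_shift)
  have F_nth: "?F $$ l = (\<Sum>s\<in>S. \<Sum>j<\<alpha> s. u (s, j) * x s $$ (l + int j))" for l
    by (simp add: fls_nth_sum a_def sum_distrib_right mult.assoc shift)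
  have F0: "?F $$ l = 0" if "1 \<le> l" "l \<le> int M" for l
  proof -
    define n where "n = nat (l - 1)"
    have n: "n < M" "int n + 1 = l" using that by (auto simp: n_def)
    show ?thesis
      using rel[rule_format, OF n(1)] fin
      by (simp add: F_nth sum.Sigma split_beta n(2))
  qed
  obtain b where b: "polynomial_fls b" "vanishes_below 1 (b + ?F)"
    using ex_polynomial_part by blast
  have "vanishes_below (int M + 1) (b + ?F)"
    unfolding vanishes_below_def
  proof (intro allI impI)
    fix l assume "l < int M + 1"
    then show "(b + ?F) $$ l = 0"
      using b F0[of l] by (cases "l < 1") (auto simp: vanishes_below_def polynomial_fls_def)
  qed
  with that b(1) pol van anz show ?thesis by blast
qed

text \<open>The simplex lemma in dual form: the rational points \<open>p/q\<close> of height at most \<open>h^M\<close> close to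
  some \<open>y\<close> in the box around \<open>x\<close> lie on a common hyperplane.\<close>
lemma linear_form_at_approximation:
  fixes x :: "nat \<Rightarrow> 'a::{field,finite} fls"
  assumes ab: "polynomial_fls b" "\<And>s. polynomial_fls (a s)"
    "\<And>s. vanishes_below (1 - int (\<alpha> s)) (a s)"
    "vanishes_below (int M + 1) (b + (\<Sum>s\<in>S. a s * x s))"
    and y: "\<And>s. s \<in> S \<Longrightarrow> vanishes_below (int (\<alpha> s + M)) (y s - x s)"
    and q: "polynomial_fls q" "vanishes_below (- int M) q" and p: "\<And>s. polynomial_fls (p s)"
    and approx: "\<And>s. s \<in> S \<Longrightarrow> vanishes_below (int (\<alpha> s)) (q * y s - p s)"
  shows "q * (b + (\<Sum>s\<in>S. a s * y s)) = (\<Sum>s\<in>S. a s * (q * y s - p s))"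
proof -
  \<comment> \<open>The form is as small at \<open>y\<close> as at \<open>x\<close>:
    \<open>a s\<close> has degree below \<open>\<alpha> s\<close>, which the factor h^(-\<alpha> s)
    in the side of the box compensates.\<close>
  have "vanishes_below (int M + 1) (\<Sum>s\<in>S. a s * (y s - x s))"
    by (intro vanishes_below_sum vanishes_below_mult[OF ab(3) y]) auto
  from vanishes_below_add[OF ab(4) this]
  have "vanishes_below (int M + 1) (b + (\<Sum>s\<in>S. a s * y s))"
    by (simp add: right_diff_distrib sum_subtractf)
  then have 1: "vanishes_below 1 (q * (b + (\<Sum>s\<in>S. a s * y s)))"
    by (rule vanishes_below_mult[OF q(2)]) simp
  have 2: "vanishes_below 1 (\<Sum>s\<in>S. a s * (q * y s - p s))"
    by (intro vanishes_below_sum vanishes_below_mult[OF ab(3) approx]) auto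
  \<comment> \<open>Both terms of \<open>?d\<close> have absolute value below 1, while the
    cancellation of \<open>q * y s\<close> leaves the polynomial \<open>?e\<close>; so the
    difference is 0.\<close>
  have eq: "q * (b + (\<Sum>s\<in>S. a s * y s)) - (\<Sum>s\<in>S. a s * (q * y s - p s))
      = q * b + (\<Sum>s\<in>S. a s * p s)" (is "?d = ?e")
    by (simp add: algebra_simps sum_subtractf sum_distrib_left)
  have "polynomial_fls ?e"
    by (intro polynomial_fls_add polynomial_fls_mult polynomial_fls_sum ab q p)
  moreover have "vanishes_below 1 ?d" using 1 2 by (rule vanishes_below_diff)
  ultimately have "?d = 0"
    unfolding eq by (intro polynomial_vanishes_below_1)
  then show ?thesis by simp
qed

text \<open>The degree of \<open>q\<close> is \<open>- fls_subdegree q\<close>; it ranges over the window \<open>[T - k, T)\<close>.\<close>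
definition approximable ::
  "nat set \<Rightarrow> (nat \<Rightarrow> nat) \<Rightarrow> nat \<Rightarrow> nat \<Rightarrow> (nat \<Rightarrow> 'a::{field,finite} fls) \<Rightarrow> bool" where
  "approximable S \<alpha> k T y \<longleftrightarrow> (\<exists>q p. q \<noteq> 0 \<and> polynomial_fls q \<and> (\<forall>s. polynomial_fls (p s)) \<and>
     int T - int k \<le> - fls_subdegree q \<and> - fls_subdegree q < int T \<and>
     (\<forall>s\<in>S. vanishes_below (int (\<alpha> s + k + 1)) (q * y s - p s)))"

text \<open>Hence one coefficient, in the direction \<open>s\<^sub>0\<close> in which the hyperplane is steepest relative to
  the box, separates the neighbourhoods of the hyperplane.\<close>
lemma ex_separating_coordinate:
  fixes x :: "nat \<Rightarrow> 'a::{field,finite} fls"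
  assumes fin: "finite S" and T: "0 < T" "T \<le> (\<Sum>s\<in>S. \<alpha> s)"
  obtains s0 where "s0 \<in> S"
    "\<And>z z' y y'. \<lbrakk>\<And>s. s \<in> S \<Longrightarrow> vanishes_below (int (T + \<alpha> s)) (z s - x s);
       \<And>s. s \<in> S \<Longrightarrow> vanishes_below (int (T + \<alpha> s)) (z' s - x s);
       \<And>s. s \<in> S \<Longrightarrow> vanishes_below (int (T + \<alpha> s + 1)) (y s - z s);
       \<And>s. s \<in> S \<Longrightarrow> vanishes_below (int (T + \<alpha> s + 1)) (y' s - z' s);
       approximable S \<alpha> k T y; approximable S \<alpha> k T y';
       \<And>s. s \<in> S \<Longrightarrow> s \<noteq> s0 \<Longrightarrow> z' s = z s\<rbrakk>
      \<Longrightarrow> (z' s0 - z s0) $$ int (T + \<alpha> s0) = 0"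
proof -
  have "T - 1 < (\<Sum>s\<in>S. \<alpha> s)" using T by simp
  then obtain b a where ab: "polynomial_fls b" "\<And>s. polynomial_fls (a s)"
    "\<And>s. vanishes_below (1 - int (\<alpha> s)) (a s)"
    and anz: "\<exists>s\<in>S. a s \<noteq> 0"
    and form: "vanishes_below (int (T - 1) + 1) (b + (\<Sum>s\<in>S. a s * x s))"
    by (rule ex_small_linear_form[OF fin, where x = x]) blast
  \<comment> \<open>h^(-\<open>?f s\<close>) is the size of the variation of
    \<open>a s * z s\<close> over the box, so minimising \<open>?f\<close> selects the coordinate in
    which the form varies most; \<mu> records that variation.\<close>
  let ?f = "\<lambda>s. fls_subdegree (a s) + int (T + \<alpha> s)"
  let ?S = "{s\<in>S. a s \<noteq> 0}"
  define s0 where "s0 = arg_min_on ?f ?S"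
  have ne: "finite ?S" "?S \<noteq> {}" using fin anz by auto
  have s0: "s0 \<in> S" "a s0 \<noteq> 0"
    using arg_min_if_finite(1)[OF ne, of ?f] by (auto simp: s0_def)
  have s0_min: "?f s0 \<le> ?f s" if "s \<in> S" "a s \<noteq> 0" for s
    using arg_min_least[OF ne, of s ?f] that by (auto simp: s0_def)
  define \<mu> where "\<mu> = ?f s0"
  have av: "vanishes_below (\<mu> - int (T + \<alpha> s)) (a s)" if "s \<in> S" for s
    using s0_min[OF that] by (cases "a s = 0") (auto simp: vanishes_below_iff_subdegree \<mu>_def)
  \<comment> \<open>A child containing an approximable point lies in a thin slab: the form there is
    smaller by a factor h than its variation over the box.\<close>
  have key: "vanishes_below (\<mu> + 1) (b + (\<Sum>s\<in>S. a s * z s))"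
    if z: "\<And>s. s \<in> S \<Longrightarrow> vanishes_below (int (T + \<alpha> s)) (z s - x s)"
      and y: "\<And>s. s \<in> S \<Longrightarrow> vanishes_below (int (T + \<alpha> s + 1)) (y s - z s)"
      and ap: "approximable S \<alpha> k T y" for y z
  proof -
    from ap obtain q p where q: "q \<noteq> 0" "polynomial_fls q" and p: "\<And>s. polynomial_fls (p s)"
      and deg: "int T - int k \<le> - fls_subdegree q" "- fls_subdegree q < int T"
      and close: "\<And>s. s \<in> S \<Longrightarrow> vanishes_below (int (\<alpha> s + k + 1)) (q * y s - p s)"
      unfolding approximable_def by blast
    have yx: "vanishes_below (int (\<alpha> s + (T - 1))) (y s - x s)" if "s \<in> S" for s
    proof -
      have "vanishes_below (int (T + \<alpha> s)) ((y s - z s) + (z s - x s))"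
        by (intro vanishes_below_add z[OF that] vanishes_below_mono[OF y[OF that]]) simp
      then show ?thesis
        by simp (erule vanishes_below_mono, use T in simp)
    qed
    have "vanishes_below (- int (T - 1)) q"
      using deg T by (auto simp: vanishes_below_iff_subdegree)
    moreover have "vanishes_below (int (\<alpha> s)) (q * y s - p s)" if "s \<in> S" for s
      using close[OF that] by (rule vanishes_below_mono) simp
    ultimately have id: "q * (b + (\<Sum>s\<in>S. a s * y s)) = (\<Sum>s\<in>S. a s * (q * y s - p s))"
      by (intro linear_form_at_approximation[OF ab form yx q(2) _ p])
    \<comment> \<open>The exponents add up to (\<mu> - T - \<alpha> s) + (\<alpha> s + k + 1).
      Dividing by \<open>q\<close>, of degree at least T - k, leaves \<mu> + 1; this is the purpose
      of the surplus k + 1 in \<open>approximable\<close>.\<close>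
    have "vanishes_below (\<mu> - int T + int k + 1) (\<Sum>s\<in>S. a s * (q * y s - p s))"
      by (intro vanishes_below_sum vanishes_below_mult[OF av close]) auto
    then have "vanishes_below (\<mu> + 1) (b + (\<Sum>s\<in>S. a s * y s))"
      unfolding id[symmetric] by (rule vanishes_below_mult_cancel[OF q(1)]) (use deg in simp)
    moreover have "vanishes_below (\<mu> + 1) (\<Sum>s\<in>S. a s * (y s - z s))"
      by (intro vanishes_below_sum vanishes_below_mult[OF av y]) auto
    ultimately have "vanishes_below (\<mu> + 1)
        ((b + (\<Sum>s\<in>S. a s * y s)) - (\<Sum>s\<in>S. a s * (y s - z s)))"
      by (rule vanishes_below_diff)
    then show ?thesis
      by (simp add: algebra_simps sum_subtractf)
  qed
  show ?thesis
  proof (rule that[OF s0(1)])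
    fix z z' y y' :: "nat \<Rightarrow> 'a fls"
    assume z: "\<And>s. s \<in> S \<Longrightarrow> vanishes_below (int (T + \<alpha> s)) (z s - x s)"
      "\<And>s. s \<in> S \<Longrightarrow> vanishes_below (int (T + \<alpha> s)) (z' s - x s)"
      "\<And>s. s \<in> S \<Longrightarrow> vanishes_below (int (T + \<alpha> s + 1)) (y s - z s)"
      "\<And>s. s \<in> S \<Longrightarrow> vanishes_below (int (T + \<alpha> s + 1)) (y' s - z' s)"
      "approximable S \<alpha> k T y" "approximable S \<alpha> k T y'"
      and eq: "\<And>s. s \<in> S \<Longrightarrow> s \<noteq> s0 \<Longrightarrow> z' s = z s"
    have "vanishes_below (\<mu> + 1) ((b + (\<Sum>s\<in>S. a s * z' s)) - (b + (\<Sum>s\<in>S. a s * z s)))"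
      by (intro vanishes_below_diff key[OF z(1) z(3) z(5)] key[OF z(2) z(4) z(6)])
    also have "(b + (\<Sum>s\<in>S. a s * z' s)) - (b + (\<Sum>s\<in>S. a s * z s)) = (\<Sum>s\<in>S. a s * (z' s - z s))"
      by (simp add: right_diff_distrib sum_subtractf)
    also have "\<dots> = (\<Sum>s\<in>S. if s = s0 then a s0 * (z' s0 - z s0) else 0)"
      using eq by (intro sum.cong) auto
    also have "\<dots> = a s0 * (z' s0 - z s0)"
      using fin s0(1) by simp
    finally have "vanishes_below (int (T + \<alpha> s0) + 1) (z' s0 - z s0)"
      by (rule vanishes_below_mult_cancel[OF s0(2)]) (simp add: \<mu>_def)
    then show "(z' s0 - z s0) $$ int (T + \<alpha> s0) = 0"
      by (simp add: vanishes_below_def)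
  qed
qed

section \<open>Trees with many good children\<close>

lemma card_PiE_extensions:
  fixes v :: "'p \<Rightarrow> 'a::finite"
  assumes fin: "finite B" and sub: "A \<subseteq> B" and v: "v \<in> A \<rightarrow>\<^sub>E UNIV"
  shows "card {z \<in> B \<rightarrow>\<^sub>E UNIV. restrict z A = v} = CARD('a) ^ (card B - card A)"
proof -
  have vA: "v p = undefined" if "p \<notin> A" for p
    using v that by auto
  have "bij_betw (\<lambda>z. restrict z (B - A)) {z \<in> B \<rightarrow>\<^sub>E UNIV. restrict z A = v}
      ((B - A) \<rightarrow>\<^sub>E (UNIV :: 'a set))"
  proof (rule bij_betw_byWitness[where f' = "\<lambda>c p. if p \<in> A then v p else c p"])
    show "\<forall>z\<in>{z \<in> B \<rightarrow>\<^sub>E UNIV. restrict z A = v}.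
        (\<lambda>p. if p \<in> A then v p else restrict z (B - A) p) = z"
      by (auto simp: fun_eq_iff PiE_def extensional_def)
    show "\<forall>c\<in>(B - A) \<rightarrow>\<^sub>E UNIV. restrict (\<lambda>p. if p \<in> A then v p else c p) (B - A) = c"
      by (auto simp: fun_eq_iff PiE_def extensional_def)
    show "(\<lambda>z. restrict z (B - A)) ` {z \<in> B \<rightarrow>\<^sub>E UNIV. restrict z A = v} \<subseteq> (B - A) \<rightarrow>\<^sub>E UNIV"
      by (auto simp: PiE_def extensional_def)
    show "(\<lambda>c p. if p \<in> A then v p else c p) ` ((B - A) \<rightarrow>\<^sub>E UNIV)
        \<subseteq> {z \<in> B \<rightarrow>\<^sub>E UNIV. restrict z A = v}"
      using sub vA by (auto simp: PiE_def extensional_def fun_eq_iff)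
  qed
  then have "card {z \<in> B \<rightarrow>\<^sub>E UNIV. restrict z A = v} = card ((B - A) \<rightarrow>\<^sub>E (UNIV :: 'a set))"
    by (rule bij_betw_same_card)
  also have "\<dots> = CARD('a) ^ (card B - card A)"
    using fin sub by (simp add: card_PiE card_Diff_subset finite_subset)
  finally show ?thesis .
qed

text \<open>The mass distribution principle in a finitary form: descending through the tree of restrictions
  along good children, one keeps the expected number of forbidden nodes still ahead below 1.\<close>
lemma ex_good_path_avoiding:
  fixes D :: "nat \<Rightarrow> 'p set" and good :: "nat \<Rightarrow> ('p \<Rightarrow> 'a::finite) \<Rightarrow> bool"
    and C :: "nat \<Rightarrow> ('p \<Rightarrow> 'a) set" and lev :: "nat \<Rightarrow> nat"
  defines "W \<equiv> \<lambda>J. real CARD('a) ^ card (D J) / 2 ^ J"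
  assumes finD: "\<And>J. finite (D J)" and mono: "\<And>J. D J \<subseteq> D (Suc J)"
    and half: "\<And>J v. v \<in> D J \<rightarrow>\<^sub>E UNIV \<Longrightarrow>
      2 * card {z \<in> D (Suc J) \<rightarrow>\<^sub>E UNIV. restrict z (D J) = v \<and> \<not> good J z}
        \<le> CARD('a) ^ (card (D (Suc J)) - card (D J))"
    and C: "\<And>j. C j \<subseteq> D (lev j) \<rightarrow>\<^sub>E UNIV"
    and small: "(\<Sum>j. ennreal (real (card (C j)) * W 0 / W (lev j))) < 1"
  shows "\<exists>w. (\<forall>J. good J (restrict w (D (Suc J)))) \<and> (\<forall>j. restrict w (D (lev j)) \<notin> C j)"
proof -
  have Dle: "D m \<subseteq> D n" if "m \<le> n" for m n
    using that mono by (rule lift_Suc_mono_le[of D, rotated])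
  have finC: "finite (C j)" for j
    by (rule finite_subset[OF C finite_PiE]) (simp_all add: finD)
  have Wpos: "0 < W J" for J by (simp add: W_def)
  \<comment> \<open>\<open>n\<close> counts the forbidden nodes of \<open>C j\<close> below
    \<open>v\<close>, and is 0 once their level has been passed. Choosing each time among at least
    \<open>W (Suc J) / W J\<close> good children, uniformly at random, one hits \<open>C j\<close>
    with probability at most \<open>t J v j\<close>.\<close>
  define n where "n J v j = (if J \<le> lev j then card {c \<in> C j. restrict c (D J) = v} else 0)" for J v j
  define t where "t J v j = ennreal (real (n J v j) * W J / W (lev j))" for J v j
  define P where "P J v \<longleftrightarrow> v \<in> D J \<rightarrow>\<^sub>E UNIV \<and> (\<Sum>j. t J v j) < 1" for J v
  define Q where "Q J v z \<longleftrightarrow> restrict z (D J) = v \<and> good J z" for J v z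
  have "\<exists>f. \<forall>J. P J (f J) \<and> Q J (f J) (f (Suc J))"
  proof (rule dependent_nat_choice)
    let ?v = "restrict undefined (D 0) :: 'p \<Rightarrow> 'a"
    have "t 0 ?v j \<le> ennreal (real (card (C j)) * W 0 / W (lev j))" for j
      unfolding t_def n_def
      by (intro ennreal_leI divide_right_mono mult_right_mono)
        (auto intro!: card_mono finC less_imp_le[OF Wpos])
    then have "(\<Sum>j. t 0 ?v j) \<le> (\<Sum>j. ennreal (real (card (C j)) * W 0 / W (lev j)))"
      by (intro suminf_le) auto
    then have "P 0 ?v" using small by (auto simp: P_def)
    then show "\<exists>v. P 0 v" by blast
  next
    fix v J assume "P J v"
    then have v: "v \<in> D J \<rightarrow>\<^sub>E UNIV" and \<Phi>: "(\<Sum>j. t J v j) < 1" by (auto simp: P_def)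
    let ?Ch = "{z \<in> D (Suc J) \<rightarrow>\<^sub>E UNIV. restrict z (D J) = v}"
    let ?G = "{z \<in> ?Ch. good J z}"
    let ?B = "{z \<in> D (Suc J) \<rightarrow>\<^sub>E UNIV. restrict z (D J) = v \<and> \<not> good J z}"
    have finCh: "finite ?Ch" using finD
      by (intro finite_subset[OF _ finite_PiE[of "D (Suc J)" "\<lambda>_. UNIV"]]) auto
    have finGB: "finite ?G" "finite ?B"
      by (rule finite_subset[OF _ finCh], blast)+
    define H where "H = real CARD('a) ^ (card (D (Suc J)) - card (D J)) / 2"
    have Hpos: "0 < H" by (simp add: H_def)
    have cle: "card (D J) \<le> card (D (Suc J))" using mono finD by (auto intro: card_mono)
    have WS: "W (Suc J) = W J * H"
      using cle by (simp add: W_def H_def power_add[symmetric])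
    have "?Ch = ?G \<union> ?B" by blast
    then have "card ?Ch = card (?G \<union> ?B)" by (rule arg_cong)
    also have "\<dots> = card ?G + card ?B"
      using finGB by (intro card_Un_disjoint) auto
    finally have "card ?G + card ?B = card ?Ch" by (rule sym)
    also have "\<dots> = CARD('a) ^ (card (D (Suc J)) - card (D J))"
      by (rule card_PiE_extensions[OF finD mono v])
    finally have "CARD('a) ^ (card (D (Suc J)) - card (D J)) \<le> 2 * card ?G"
      using half[OF v] by linarith
    then have "real (CARD('a) ^ (card (D (Suc J)) - card (D J))) \<le> real (2 * card ?G)"
      by (rule of_nat_mono)
    then have cardG: "H \<le> real (card ?G)" by (simp add: H_def)
    \<comment> \<open>Each forbidden node further down lies below exactly one child. The inequality
      is lost only when the level of \<open>C j\<close> is passed.\<close>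
    have count: "(\<Sum>z\<in>?Ch. real (n (Suc J) z j)) \<le> real (n J v j)" for j
    proof (cases "Suc J \<le> lev j")
      case True
      have "(\<Sum>z\<in>?Ch. n (Suc J) z j) = card (\<Union>z\<in>?Ch. {c \<in> C j. restrict c (D (Suc J)) = z})"
        using True finC finCh by (subst card_UN_disjoint) (auto simp: n_def)
      also have "\<dots> \<le> card {c \<in> C j. restrict c (D J) = v}"
        using mono[of J] finC by (intro card_mono) (auto simp: restrict_restrict inf.absorb2)
      also have "\<dots> = n J v j" using True by (simp add: n_def)
      finally show ?thesis unfolding of_nat_sum[symmetric] by (rule of_nat_mono)
    qed (auto simp: n_def)
    have term_le: "(\<Sum>z\<in>?Ch. t (Suc J) z j) \<le> ennreal H * t J v j" for j
    proof -
      define c where "c = W (Suc J) / W (lev j)"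
      have c: "0 \<le> c" using Wpos by (simp add: c_def less_imp_le)
      have "(\<Sum>z\<in>?Ch. t (Suc J) z j) = (\<Sum>z\<in>?Ch. ennreal (real (n (Suc J) z j) * c))"
        by (simp add: t_def c_def)
      also have "\<dots> = ennreal (\<Sum>z\<in>?Ch. real (n (Suc J) z j) * c)"
        using c by (intro sum_ennreal) simp
      also have "\<dots> \<le> ennreal (real (n J v j) * c)"
        unfolding sum_distrib_right[symmetric] using c by (intro ennreal_leI mult_right_mono count)
      also have "real (n J v j) * c = H * (real (n J v j) * W J / W (lev j))"
        by (simp add: c_def WS)
      also have "ennreal \<dots> = ennreal H * t J v j"
        unfolding t_def using Hpos less_imp_le[OF Wpos]
        by (intro ennreal_mult) (auto intro!: divide_nonneg_nonneg mult_nonneg_nonneg)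
      finally show ?thesis .
    qed
    \<comment> \<open>Averaging: if every good child had total at least 1, the totals would add up
      to at least \<open>card ?G\<close>, hence at least \<open>H\<close>; but over all children
      they add up to less than \<open>H\<close>.\<close>
    have "\<exists>z\<in>?G. (\<Sum>j. t (Suc J) z j) < 1"
    proof (rule ccontr)
      assume "\<not> ?thesis"
      then have "(\<Sum>z\<in>?G. 1) \<le> (\<Sum>z\<in>?G. \<Sum>j. t (Suc J) z j)"
        by (intro sum_mono) (auto simp: not_less)
      also have "\<dots> \<le> (\<Sum>z\<in>?Ch. \<Sum>j. t (Suc J) z j)"
        using finCh by (intro sum_mono2) auto
      also have "\<dots> = (\<Sum>j. \<Sum>z\<in>?Ch. t (Suc J) z j)"
        by (rule suminf_sum[symmetric]) simp
      also have "\<dots> \<le> (\<Sum>j. ennreal H * t J v j)"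
        by (intro suminf_le term_le) auto
      also have "\<dots> = ennreal H * (\<Sum>j. t J v j)" by simp
      also have "\<dots> < ennreal H * 1"
        using \<Phi> Hpos by (intro ennreal_mult_strict_left_mono) auto
      finally have "ennreal (real (card ?G)) < ennreal H"
        by (simp add: ennreal_of_nat_eq_real_of_nat)
      then show False
        using cardG Hpos by (simp add: ennreal_less_iff)
    qed
    then show "\<exists>z. P (Suc J) z \<and> Q J v z"
      by (auto simp: P_def Q_def)
  qed
  then obtain f where PQ: "\<And>J. P J (f J) \<and> Q J (f J) (f (Suc J))" by blast
  have f: "f J \<in> D J \<rightarrow>\<^sub>E UNIV" "(\<Sum>j. t J (f J) j) < 1"
    "restrict (f (Suc J)) (D J) = f J" "good J (f (Suc J))" for J
    using PQ[of J] by (simp_all add: P_def Q_def)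
  have f_restrict: "restrict (f (m + d)) (D m) = f m" for m d
  proof (induction d)
    case 0
    then show ?case using f(1)[of m] by (simp add: PiE_restrict)
  next
    case (Suc d)
    have "restrict (f (m + Suc d)) (D m) = restrict (restrict (f (Suc (m + d))) (D (m + d))) (D m)"
      using Dle[of m "m + d"] by (simp add: restrict_restrict inf.absorb2)
    also have "\<dots> = f m" unfolding f(3) by (rule Suc.IH)
    finally show ?case .
  qed
  define w where "w p = f (LEAST m. p \<in> D m) p" for p
  have w: "restrict w (D J) = f J" for J
  proof
    fix p
    show "restrict w (D J) p = f J p"
    proof (cases "p \<in> D J")
      case True
      define m where "m = (LEAST m. p \<in> D m)"
      have m: "p \<in> D m" "m \<le> J"
        using True unfolding m_def by (auto intro: LeastI Least_le)
      have "f m p = f J p"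
        using fun_cong[OF f_restrict[of m "J - m"], of p] m by simp
      then show ?thesis using True by (simp add: w_def m_def)
    next
      case False
      then show ?thesis using f(1)[of J] by auto
    qed
  qed
  have "f (lev j) \<notin> C j" for j
  proof
    assume *: "f (lev j) \<in> C j"
    have "{c \<in> C j. restrict c (D (lev j)) = f (lev j)} \<noteq> {}"
      using * f(1)[of "lev j"] by (auto simp: PiE_restrict)
    then have "1 \<le> n (lev j) (f (lev j)) j"
      using finC by (simp add: n_def Suc_le_eq card_gt_0_iff)
    \<comment> \<open>At this level the two weights cancel, so \<open>t\<close> is the plain count,
      and a hit would make the total at least 1.\<close>
    then have "1 \<le> t (lev j) (f (lev j)) j"
      using Wpos[of "lev j"] by (simp add: t_def)
    also have "\<dots> \<le> (\<Sum>j'. t (lev j) (f (lev j)) j')"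
      using sum_le_suminf[of "\<lambda>j'. t (lev j) (f (lev j)) j'" "{j}"] by simp
    finally show False using f(2)[of "lev j"] by simp
  qed
  then show ?thesis
    using f(4) by (intro exI[of _ w]) (simp add: w)
qed

section \<open>Boxes without good approximations\<close>

text \<open>Only exponents \<open>l\<close> \<ge> 0 of X^(-1) occur: for the lower bound it is
  enough to search for points in the unit ball.\<close>

definition fls_point :: "nat \<Rightarrow> (nat \<times> nat \<Rightarrow> 'a::{field,finite}) \<Rightarrow> nat \<Rightarrow> 'a fls" where
  "fls_point N u = (\<lambda>s. if s < N then fps_to_fls (Abs_fps (\<lambda>l. u (s, l))) else 0)"

lemma fls_point_in_lspace: "fls_point N u \<in> lspace N"
  by (simp add: fls_point_def lspace_def)

lemma fls_point_nth: "s < N \<Longrightarrow> fls_point N u s $$ l = (if l < 0 then 0 else u (s, nat l))"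
  by (simp add: fls_point_def)

lemma vanishes_below_fls_point_diff:
  assumes "s < N" and "\<And>l. l < m \<Longrightarrow> u (s, l) = v (s, l)"
  shows "vanishes_below (int m) (fls_point N u s - fls_point N v s)"
  unfolding vanishes_below_def
proof (intro allI impI)
  fix l assume "l < int m"
  then show "(fls_point N u s - fls_point N v s) $$ l = 0"
    using assms(1) assms(2)[of "nat l"] by (cases "l < 0") (simp_all add: fls_point_nth)
qed

text \<open>A node of the tree is a function on such a set: it prescribes the first
  \<open>L s\<close> coefficients of coordinate \<open>s\<close>, which describes a box with sides
  h^(-\<open>L s\<close>).\<close>

definition box_indices :: "nat \<Rightarrow> (nat \<Rightarrow> nat) \<Rightarrow> (nat \<times> nat) set" where
  "box_indices N L = Sigma {..<N} (\<lambda>s. {..<L s})"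

lemma finite_box_indices: "finite (box_indices N L)"
  by (simp add: box_indices_def)

text \<open>Adding 1 to the coefficient at the separating position maps children injectively to
  children and never a bad one to a bad one, because two bad children that agree elsewhere also
  agree there. This gives one half over every field, including the one with two elements.\<close>

lemma card_bad_children:
  fixes v :: "nat \<times> nat \<Rightarrow> 'a::{field,finite}" and k :: nat
  assumes S: "S \<subseteq> {..<N}" and T: "0 < T" "T \<le> (\<Sum>s\<in>S. \<alpha> s)"
    and L: "\<And>s. s < N \<Longrightarrow> T + \<alpha> s + 1 \<le> L s"
    and v: "v \<in> box_indices N (\<lambda>s. T + \<alpha> s) \<rightarrow>\<^sub>E UNIV"
  defines "Ch \<equiv> {z \<in> box_indices N L \<rightarrow>\<^sub>E UNIV. restrict z (box_indices N (\<lambda>s. T + \<alpha> s)) = v}"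
  defines "bad \<equiv> \<lambda>z. \<exists>y. (\<forall>s\<in>S. vanishes_below (int (T + \<alpha> s + 1)) (y s - fls_point N z s)) \<and>
    approximable S \<alpha> k T y"
  shows "2 * card {z \<in> Ch. bad z} \<le> card Ch"
proof -
  let ?x = "fls_point N v"
  have finS: "finite S" using S by (rule finite_subset) simp
  obtain s0 where s0: "s0 \<in> S" and sep:
    "\<And>z z' y y'. \<lbrakk>\<And>s. s \<in> S \<Longrightarrow> vanishes_below (int (T + \<alpha> s)) (z s - ?x s);
       \<And>s. s \<in> S \<Longrightarrow> vanishes_below (int (T + \<alpha> s)) (z' s - ?x s);
       \<And>s. s \<in> S \<Longrightarrow> vanishes_below (int (T + \<alpha> s + 1)) (y s - z s);
       \<And>s. s \<in> S \<Longrightarrow> vanishes_below (int (T + \<alpha> s + 1)) (y' s - z' s);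
       approximable S \<alpha> k T y; approximable S \<alpha> k T y';
       \<And>s. s \<in> S \<Longrightarrow> s \<noteq> s0 \<Longrightarrow> z' s = z s\<rbrakk>
      \<Longrightarrow> (z' s0 - z s0) $$ int (T + \<alpha> s0) = 0"
    by (rule ex_separating_coordinate[OF finS T, where x = ?x and k = k]) blast
  have s0N: "s0 < N" using s0 S by auto
  \<comment> \<open>The first coefficient of coordinate \<open>s0\<close> that the parent leaves
    free; the bound on \<open>L\<close> puts it among those fixed by the children.\<close>
  define r where "r = (s0, T + \<alpha> s0)"
  have r: "r \<in> box_indices N L" "r \<notin> box_indices N (\<lambda>s. T + \<alpha> s)"
    using s0N L[of s0] by (auto simp: r_def box_indices_def)
  define \<phi> :: "(nat \<times> nat \<Rightarrow> 'a) \<Rightarrow> nat \<times> nat \<Rightarrow> 'a" where "\<phi> z = z(r := z r + 1)" for z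
  have \<phi>Ch: "\<phi> z \<in> Ch" if "z \<in> Ch" for z
  proof -
    have "\<phi> z \<in> box_indices N L \<rightarrow>\<^sub>E UNIV"
      using that r(1) by (auto simp: Ch_def \<phi>_def PiE_def extensional_def)
    moreover have "restrict (\<phi> z) (box_indices N (\<lambda>s. T + \<alpha> s))
        = restrict z (box_indices N (\<lambda>s. T + \<alpha> s))"
      using r(2) by (auto simp: \<phi>_def fun_eq_iff)
    ultimately show ?thesis using that by (simp add: Ch_def)
  qed
  have inj: "inj_on \<phi> A" for A
  proof (rule inj_onI)
    fix z z' assume eq: "\<phi> z = \<phi> z'"
    have "z p = z' p" for p
      using fun_cong[OF eq, of p] by (cases "p = r") (auto simp: \<phi>_def)
    then show "z = z'" by blast
  qed
  have finCh: "finite Ch"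
    unfolding Ch_def
    by (rule finite_subset[OF _ finite_PiE[of "box_indices N L" "\<lambda>_. UNIV"]])
      (auto simp: finite_box_indices)
  have near: "vanishes_below (int (T + \<alpha> s)) (fls_point N z s - ?x s)" if "z \<in> Ch" "s \<in> S" for z s
  proof (rule vanishes_below_fls_point_diff)
    show "s < N" using that S by auto
    fix l assume "l < T + \<alpha> s"
    then have "(s, l) \<in> box_indices N (\<lambda>s. T + \<alpha> s)"
      using \<open>s < N\<close> by (simp add: box_indices_def)
    moreover have "restrict z (box_indices N (\<lambda>s. T + \<alpha> s)) = v" using that by (simp add: Ch_def)
    ultimately show "z (s, l) = v (s, l)" by (metis restrict_apply')
  qed
  have not_both: "\<not> bad (\<phi> z)" if z: "z \<in> Ch" "bad z" for z
  proof
    assume "bad (\<phi> z)"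
    with z(2) obtain y y' where
      "\<And>s. s \<in> S \<Longrightarrow> vanishes_below (int (T + \<alpha> s + 1)) (y s - fls_point N z s)"
      "\<And>s. s \<in> S \<Longrightarrow> vanishes_below (int (T + \<alpha> s + 1)) (y' s - fls_point N (\<phi> z) s)"
      "approximable S \<alpha> k T y" "approximable S \<alpha> k T y'"
      unfolding bad_def by blast
    moreover have "fls_point N (\<phi> z) s = fls_point N z s" if "s \<noteq> s0" for s
      using that by (simp add: fls_point_def \<phi>_def r_def)
    ultimately have "(fls_point N (\<phi> z) s0 - fls_point N z s0) $$ int (T + \<alpha> s0) = 0"
      by (intro sep[of "fls_point N z" "fls_point N (\<phi> z)" y y'] near \<phi>Ch z(1)) auto
    then show False
      using s0N by (simp add: fls_point_nth \<phi>_def r_def del: of_nat_add)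
  qed
  let ?B = "{z \<in> Ch. bad z}"
  have finB: "finite ?B" using finCh by simp
  have "2 * card ?B = card ?B + card (\<phi> ` ?B)"
    using inj by (simp add: card_image)
  also have "\<dots> = card (?B \<union> \<phi> ` ?B)"
    using finB not_both by (intro card_Un_disjoint[symmetric]) auto
  also have "\<dots> \<le> card Ch"
    using finCh \<phi>Ch by (intro card_mono) auto
  finally show ?thesis .
qed

text \<open>Every degree lies in exactly one window, so each \<open>q\<close> is tested at one
  level. The window length and the rounding of the exponents cost only a bounded power of h, which
  goes into c.\<close>

lemma Bad_if_not_approximable:
  fixes i :: "nat \<Rightarrow> real" and y :: "nat \<Rightarrow> 'a::{field,finite} fls"
  assumes nonneg: "\<forall>s<N. i s \<ge> 0" and k: "0 < k" and y: "y \<in> lspace N"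
  defines "S \<equiv> {s. s < N \<and> i s \<noteq> 0}"
  assumes ne: "S \<noteq> {}"
    and napp: "\<And>J. \<not> approximable S (\<lambda>s. nat \<lceil>real (Suc J * k) * i s\<rceil>) k (Suc J * k) y"
  shows "y \<in> Bad N i"
proof -
  let ?h = "real CARD('a)"
  have h: "1 < ?h" using card_field_ge_2[where 'a='a] by simp
  have finS: "finite S" by (simp add: S_def)
  define B where "B = Max ((\<lambda>s. 1 / i s) ` S)"
  have B: "1 / i s \<le> B" if "s \<in> S" for s
    using finS that by (simp add: B_def)
  have ipos: "0 < i s" if "s \<in> S" for s
    using that nonneg by (auto simp: S_def less_le)
  \<comment> \<open>If some |q y_s - p_s| exceeds h^(-m) with m = ceiling(T i_s) + k + 1 and T \<le>
    deg q + k, then m / i_s is at most deg q + k + (k + 2) B; the 2 is the 1 in m plus the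
    rounding.\<close>
  define c where "c = ?h powr (- (real k + real (k + 2) * B))"
  have cpos: "0 < c" using h by (simp add: c_def)
  have "c * inverse (lnorm (poly_to_fls q))
      \<le> Max ((\<lambda>s. lnorm (poly_to_fls q * y s - poly_to_fls (p s)) powr (1 / i s)) ` S)"
    for q :: "'a poly" and p :: "nat \<Rightarrow> 'a poly"
  proof -
    let ?Q = "poly_to_fls q"
    let ?g = "\<lambda>s. lnorm (?Q * y s - poly_to_fls (p s)) powr (1 / i s)"
    have Max_ge: "?g s \<le> Max (?g ` S)" if "s \<in> S" for s
      using finS that by simp
    show ?thesis
    proof (cases "?Q = 0")
      \<comment> \<open>Here \<open>inverse 0 = 0\<close> makes the left side 0.\<close>
      case True
      obtain s where "s \<in> S" using ne by blast
      have "0 \<le> ?g s" by simp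
      also have "\<dots> \<le> Max (?g ` S)" by (rule Max_ge) fact
      finally show ?thesis by (simp add: True lnorm_def)
    next
      case False
      define d where "d = nat (- fls_subdegree ?Q)"
      have d: "- fls_subdegree ?Q = int d"
        using polynomial_subdegree_le_0[OF polynomial_poly_to_fls[of q]] by (simp add: d_def)
      define J where "J = d div k"
      have J: "J * k \<le> d" "d < Suc J * k"
        using k by (auto simp: J_def dividend_less_div_times)
      have JZ: "int (Suc J * k) - int k \<le> int d" "int d < int (Suc J * k)"
        using J by (simp_all add: of_nat_mult[symmetric] del: of_nat_mult)
      have "\<not> (\<forall>s\<in>S. vanishes_below (int (nat \<lceil>real (Suc J * k) * i s\<rceil> + k + 1))
          (?Q * y s - poly_to_fls (p s)))"
      proof
        assume "\<forall>s\<in>S. vanishes_below (int (nat \<lceil>real (Suc J * k) * i s\<rceil> + k + 1))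
          (?Q * y s - poly_to_fls (p s))"
        then have "approximable S (\<lambda>s. nat \<lceil>real (Suc J * k) * i s\<rceil>) k (Suc J * k) y"
          unfolding approximable_def
          by (intro exI[of _ ?Q] exI[of _ "\<lambda>s. poly_to_fls (p s)"] conjI allI)
            (use False JZ d in \<open>simp_all add: polynomial_poly_to_fls del: mult_Suc\<close>)
        with napp show False by blast
      qed
      then obtain s where s: "s \<in> S" and
        not_close: "\<not> vanishes_below (int (nat \<lceil>real (Suc J * k) * i s\<rceil> + k + 1)) (?Q * y s - poly_to_fls (p s))"
        by blast
      define m where "m = nat \<lceil>real (Suc J * k) * i s\<rceil> + k + 1"
      have "real m \<le> real (Suc J * k) * i s + 1 + real k + 1"
        using ipos[OF s] by (simp add: m_def) linarith
      also have "real (Suc J * k) \<le> real (d + k)" using J(1) by (intro of_nat_mono) simp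
      finally have "real m \<le> real (d + k) * i s + real (k + 2)"
        using ipos[OF s] by (simp add: mult_right_mono)
      then have "real m * (1 / i s) \<le> (real (d + k) * i s + real (k + 2)) * (1 / i s)"
        using ipos[OF s] by (intro mult_right_mono) auto
      also have "\<dots> = real (d + k) + real (k + 2) * (1 / i s)"
        using ipos[OF s] by (simp add: field_simps)
      also have "\<dots> \<le> real (d + k) + real (k + 2) * B"
        by (intro add_left_mono mult_left_mono B s) simp
      finally have exponent: "real m * (1 / i s) \<le> real (d + k) + real (k + 2) * B" .
      have "c * inverse (lnorm ?Q) = ?h powr (- (real (d + k) + real (k + 2) * B))"
        using False h d by (simp add: lnorm_def c_def powr_minus[symmetric] powr_add[symmetric]
            algebra_simps flip: of_int_minus)
      also have "\<dots> \<le> ?h powr (- (real m * (1 / i s)))"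
        using h exponent by (intro powr_mono) auto
      also have "\<dots> = (?h powr (- real_of_int (int m))) powr (1 / i s)"
        using h by (simp add: powr_powr)
      also have "\<dots> \<le> ?g s"
        using not_close ipos[OF s] unfolding m_def[symmetric]
        by (intro powr_mono2) (auto simp: lnorm_le_iff_vanishes_below[symmetric])
      also have "\<dots> \<le> Max (?g ` S)" by (rule Max_ge) fact
      finally show ?thesis .
    qed
  qed
  then show ?thesis
    using y cpos unfolding Bad_def S_def by blast
qed

section \<open>Metric, diameters and scales of covering sets\<close>

lemma ldist_ge: "s < N \<Longrightarrow> lnorm (x s - y s) \<le> ldist N x y"
  unfolding ldist_def by (intro Max_ge) auto

lemma ldist_nonneg: "0 \<le> ldist N x y"
  unfolding ldist_def by (intro Max_ge) auto

lemma ldist_le: "0 \<le> r \<Longrightarrow> (\<And>s. s < N \<Longrightarrow> lnorm (x s - y s) \<le> r) \<Longrightarrow> ldist N x y \<le> r"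
  unfolding ldist_def by (subst Max_le_iff) auto

lemma ldist_le_mdiam:
  assumes bdd: "mbounded (ldist N) U" and x: "x \<in> U" and y: "y \<in> U"
  shows "ldist N x y \<le> mdiam (ldist N) U"
proof -
  obtain B where B: "\<And>x y. x \<in> U \<Longrightarrow> y \<in> U \<Longrightarrow> ldist N x y \<le> B"
    using bdd by (auto simp: mbounded_def)
  have "ldist N x y \<le> (SUP y\<in>U. ldist N x y)"
    using B x y by (intro cSUP_upper bdd_aboveI2) auto
  also have "\<dots> \<le> (SUP x\<in>U. SUP y\<in>U. ldist N x y)"
    using B x y by (intro cSUP_upper bdd_aboveI2[where M = B] cSUP_least) auto
  finally show ?thesis using x by (auto simp: mdiam_def)
qed

lemma mdiam_le:
  "0 \<le> r \<Longrightarrow> (\<And>x y. x \<in> U \<Longrightarrow> y \<in> U \<Longrightarrow> d x y \<le> r) \<Longrightarrow> mdiam d U \<le> r"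
  unfolding mdiam_def by (auto intro!: cSUP_least)

lemma mdiam_ldist_nonneg:
  assumes "mbounded (ldist N) U"
  shows "0 \<le> mdiam (ldist N) U"
proof (cases "U = {}")
  case False
  then obtain x where "x \<in> U" by blast
  then show ?thesis
    using ldist_le_mdiam[OF assms, of x x] ldist_nonneg[of N x x] by linarith
qed (simp add: mdiam_def)

lemma ex_powr_minus_le:
  fixes h a e :: real
  assumes "1 < h" "0 < a" "0 < e"
  shows "\<exists>t0::nat. \<forall>t\<ge>t0. h powr (- (real t * a)) \<le> e"
proof -
  obtain t0 :: nat where t0: "- log h e / a < real t0" using reals_Archimedean2 by blast
  have "h powr (- (real t * a)) \<le> e" if "t \<ge> t0" for t
  proof -
    have "- log h e / a < real t" using t0 that by linarith
    then have "- (real t * a) \<le> log h e" using assms by (simp add: field_simps)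
    then have "h powr (- (real t * a)) \<le> h powr (log h e)" using assms by (intro powr_mono) auto
    then show ?thesis using assms by simp
  qed
  then show ?thesis by blast
qed

text \<open>A positive diameter r is rounded up to a power h^(-t), at the price of the factor h^s'.
  If r = 0, every t is admissible and there may be nothing on the right to compare with; then t is
  taken so large that the slack \<open>e\<close> pays.\<close>

lemma ex_scale:
  fixes U :: "(nat \<Rightarrow> 'a::{field,finite} fls) set"
  assumes bdd: "mbounded (ldist N) U" and small: "mdiam (ldist N) U \<le> 1"
    and s: "0 \<le> s" "s \<le> s'" "0 < s'" and e: "0 < e"
  shows "\<exists>t::nat. (\<forall>x\<in>U. \<forall>y\<in>U. \<forall>r<N. vanishes_below (int t) (x r - y r)) \<and>
    real CARD('a) powr (- (real t * s')) \<le> real CARD('a) powr s' * diam_pow (ldist N) s U + e"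
proof -
  let ?h = "real CARD('a)" let ?r = "mdiam (ldist N) U"
  have h: "1 < ?h" using card_field_ge_2[where 'a='a] by simp
  have r0: "0 \<le> ?r" by (rule mdiam_ldist_nonneg[OF bdd])
  have dp0: "0 \<le> diam_pow (ldist N) s U" by (simp add: diam_pow_def)
  have van: "\<forall>x\<in>U. \<forall>y\<in>U. \<forall>j<N. vanishes_below (int t) (x j - y j)"
    if t: "?r \<le> ?h powr (- real t)" for t :: nat
  proof (intro ballI allI impI)
    fix x y j assume "x \<in> U" "y \<in> U" "j < N"
    then have "lnorm (x j - y j) \<le> ?r"
      using ldist_ge[of j N x y] ldist_le_mdiam[OF bdd, of x y] by linarith
    with t show "vanishes_below (int t) (x j - y j)"
      by (simp add: lnorm_le_iff_vanishes_below[symmetric])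
  qed
  show ?thesis
  proof (cases "?r = 0")
    case True
    obtain t where "?h powr (- (real t * s')) \<le> e" using ex_powr_minus_le[OF h s(3) e] by blast
    moreover have "0 \<le> ?h powr s' * diam_pow (ldist N) s U" using dp0 by simp
    ultimately show ?thesis using van[of t] True by (intro exI[of _ t]) auto
  next
    case False
    then have rpos: "0 < ?r" and Une: "U \<noteq> {}" using r0 by (auto simp: mdiam_def)
    have log: "log ?h ?r \<le> 0" using small rpos h by simp
    define t where "t = nat \<lfloor>- log ?h ?r\<rfloor>"
    have t: "real t \<le> - log ?h ?r" "- log ?h ?r < real t + 1"
      using log by (auto simp: t_def)
    have "?h powr (log ?h ?r) \<le> ?h powr (- real t)" using t h by (intro powr_mono) auto
    then have 1: "?r \<le> ?h powr (- real t)" using rpos h by simp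
    have "?h powr (- (real t + 1)) \<le> ?h powr (log ?h ?r)" using t h by (intro powr_mono) auto
    then have "?h powr (- (real t + 1)) \<le> ?r" using rpos h by simp
    then have "(?h powr (- (real t + 1))) powr s' \<le> ?r powr s'" using s by (intro powr_mono2) auto
    also have "\<dots> \<le> diam_pow (ldist N) s U"
      using s small rpos Une powr_mono'[of s s' ?r] by (auto simp: diam_pow_def powr_le1)
    finally have "?h powr s' * (?h powr (- (real t + 1))) powr s' \<le> ?h powr s' * diam_pow (ldist N) s U"
      by (intro mult_left_mono) auto
    moreover have "?h powr s' * (?h powr (- (real t + 1))) powr s' = ?h powr (- (real t * s'))"
      by (simp add: powr_powr powr_add[symmetric] algebra_simps)
    ultimately have "?h powr (- (real t * s')) \<le> ?h powr s' * diam_pow (ldist N) s U + e"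
      using e by linarith
    then show ?thesis using van[OF 1] by blast
  qed
qed

section \<open>Hausdorff dimension\<close>

text \<open>All points of \<open>U\<close> share their first \<open>t\<close> coefficients in each
  of the \<open>N\<close> coordinates, so only the remaining indices are free.\<close>

lemma card_restrictions_le:
  fixes U :: "(nat \<Rightarrow> 'a::{field,finite} fls) set"
  assumes t: "\<And>s. s < N \<Longrightarrow> t \<le> L s"
    and close: "\<forall>x\<in>U. \<forall>y\<in>U. \<forall>s<N. vanishes_below (int t) (x s - y s)"
  shows "card ((\<lambda>y. restrict (\<lambda>(s, l). y s $$ int l) (box_indices N L)) ` U)
    \<le> CARD('a) ^ (card (box_indices N L) - N * t)" (is "card (?f ` U) \<le> _")
proof (cases "U = {}")
  case False
  then obtain y0 where y0: "y0 \<in> U" by blast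
  let ?D = "box_indices N L" let ?D' = "{..<N} \<times> {..<t}"
  have sub: "?D' \<subseteq> ?D" using t by (force simp: box_indices_def)
  define v where "v = restrict (\<lambda>(s, l). y0 s $$ int l) ?D'"
  have v: "v \<in> ?D' \<rightarrow>\<^sub>E UNIV" by (simp add: v_def)
  have "?f ` U \<subseteq> {z \<in> ?D \<rightarrow>\<^sub>E UNIV. restrict z ?D' = v}"
  proof (rule image_subsetI)
    fix y assume y: "y \<in> U"
    have "y s $$ int l = y0 s $$ int l" if "s < N" "l < t" for s l
    proof -
      have "vanishes_below (int t) (y s - y0 s)" using close y y0 that by blast
      then have "(y s - y0 s) $$ int l = 0" using that unfolding vanishes_below_def by simp
      then show ?thesis by simp
    qed
    then have "restrict (?f y) ?D' = v"
      using sub by (auto simp: v_def fun_eq_iff)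
    then show "?f y \<in> {z \<in> ?D \<rightarrow>\<^sub>E UNIV. restrict z ?D' = v}" by simp
  qed
  then have "card (?f ` U) \<le> card {z \<in> ?D \<rightarrow>\<^sub>E UNIV. restrict z ?D' = v}"
    by (intro card_mono finite_subset[OF _ finite_PiE[of ?D "\<lambda>_. UNIV"]])
      (auto simp: finite_box_indices)
  also have "\<dots> = CARD('a) ^ (card ?D - card ?D')"
    by (rule card_PiE_extensions[OF finite_box_indices sub v])
  finally show ?thesis by (simp add: card_cartesian_product)
qed simp

text \<open>A cover of small total weight becomes a family of forbidden nodes of total weight below
  1. A good path avoiding them yields a badly approximable point outside the cover.\<close>

lemma hausdorff_measure_Bad_nonzero:
  fixes i :: "nat \<Rightarrow> real"
  assumes nonneg: "\<forall>r<N. i r \<ge> 0" and sum1: "(\<Sum>r<N. i r) = 1"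
    and s: "0 \<le> s" "s < real N"
  shows "hausdorff_measure (ldist N) (lspace N) s (Bad N i :: (nat \<Rightarrow> 'a::{field,finite} fls) set) \<noteq> 0"
proof
  let ?d = "ldist N :: (nat \<Rightarrow> 'a fls) \<Rightarrow> _"
  let ?E = "Bad N i :: (nat \<Rightarrow> 'a fls) set"
  assume zero: "hausdorff_measure ?d (lspace N) s ?E = 0"
  let ?h = "real CARD('a)"
  have h: "2 \<le> ?h" using card_field_ge_2[where 'a='a] by simp
  have h1: "1 < ?h" using h by simp
  have N: "0 < N" using s by (cases N) auto
  define S where "S = {r. r < N \<and> i r \<noteq> 0}"
  have SN: "S \<subseteq> {..<N}" and finS: "finite S" by (auto simp: S_def)
  have sumS: "(\<Sum>r\<in>S. i r) = 1"
    unfolding sum1[symmetric] by (rule sum.mono_neutral_left) (auto simp: S_def)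
  then have Sne: "S \<noteq> {}" by auto
  \<comment> \<open>The second condition gives s \<le> s' = N - 1/k; k \<ge> 2 keeps s' positive
    even for N = 1.\<close>
  obtain k where k: "2 \<le> k" "1 / real k \<le> real N - s"
  proof -
    obtain k0 :: nat where k0: "1 / (real N - s) < real k0" using reals_Archimedean2 by blast
    let ?k = "max 2 k0"
    have "1 / (real N - s) \<le> real ?k" using k0 by linarith
    then have "1 / real ?k \<le> real N - s"
      using s by (simp add: field_simps)
    then show ?thesis using that[of ?k] by simp
  qed
  define s' where "s' = real N - 1 / real k"
  have "1 / real k \<le> 1 / 2" using k(1) by (intro divide_left_mono) auto
  moreover have "1 \<le> real N" using N by simp
  ultimately have s': "s \<le> s'" "0 < s'" using k(2) by (simp_all add: s'_def)
  define T where "T J = Suc J * k" for J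
  define \<alpha> where "\<alpha> J r = nat \<lceil>real (T J) * i r\<rceil>" for J r
  define D where "D J = box_indices N (\<lambda>r. T J + \<alpha> J r)" for J
  define good :: "nat \<Rightarrow> (nat \<times> nat \<Rightarrow> 'a) \<Rightarrow> bool" where
    "good J z \<longleftrightarrow> \<not> (\<exists>y. (\<forall>r\<in>S. vanishes_below (int (T J + \<alpha> J r + 1)) (y r - fls_point N z r)) \<and>
      approximable S (\<alpha> J) k (T J) y)" for J z
  define W where "W J = ?h ^ card (D J) / 2 ^ J" for J
  have Wpos: "0 < W J" for J by (simp add: W_def)
  have TS: "T J + 1 \<le> T (Suc J)" for J using k(1) by (simp add: T_def)
  have \<alpha>S: "\<alpha> J r \<le> \<alpha> (Suc J) r" if "r < N" for J r
    unfolding \<alpha>_def using TS[of J] nonneg that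
    by (intro nat_mono ceiling_mono mult_right_mono) auto
  have L: "T J + \<alpha> J r + 1 \<le> T (Suc J) + \<alpha> (Suc J) r" if "r < N" for J r
    using TS[of J] \<alpha>S[OF that, of J] by linarith
  have finD: "finite (D J)" for J by (simp add: D_def finite_box_indices)
  have mono: "D J \<subseteq> D (Suc J)" for J
    unfolding D_def box_indices_def
  proof (rule Sigma_mono[OF order_refl])
    fix r assume "r \<in> {..<N}"
    then show "{..<T J + \<alpha> J r} \<subseteq> {..<T (Suc J) + \<alpha> (Suc J) r}" using L[of r J] by auto
  qed
  have T0: "0 < T J" for J using k(1) by (simp add: T_def)
  have Tsum: "T J \<le> (\<Sum>r\<in>S. \<alpha> J r)" for J
  proof -
    have "real (T J) = (\<Sum>r\<in>S. real (T J) * i r)"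
      unfolding sum_distrib_left[symmetric] sumS by simp
    also have "\<dots> \<le> (\<Sum>r\<in>S. real (\<alpha> J r))"
      unfolding \<alpha>_def by (intro sum_mono real_nat_ceiling_ge)
    finally show ?thesis unfolding of_nat_sum[symmetric] of_nat_le_iff .
  qed
  have half: "2 * card {z \<in> D (Suc J) \<rightarrow>\<^sub>E UNIV. restrict z (D J) = v \<and> \<not> good J z}
      \<le> CARD('a) ^ (card (D (Suc J)) - card (D J))" if v: "v \<in> D J \<rightarrow>\<^sub>E UNIV" for J v
  proof -
    have "2 * card {z \<in> {z \<in> D (Suc J) \<rightarrow>\<^sub>E UNIV. restrict z (D J) = v}. \<not> good J z}
        \<le> card {z \<in> D (Suc J) \<rightarrow>\<^sub>E (UNIV :: 'a set). restrict z (D J) = v}"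
      unfolding good_def not_not D_def
      by (rule card_bad_children[OF SN T0 Tsum L v[unfolded D_def]])
    also have "{z \<in> {z \<in> D (Suc J) \<rightarrow>\<^sub>E UNIV. restrict z (D J) = v}. \<not> good J z}
        = {z \<in> D (Suc J) \<rightarrow>\<^sub>E UNIV. restrict z (D J) = v \<and> \<not> good J z}" by blast
    finally show ?thesis unfolding card_PiE_extensions[OF finD mono v] .
  qed

  \<comment> \<open>\<epsilon> and the slacks \<open>e j\<close> are chosen so that, after
    multiplication by \<open>W 0\<close>, the cover contributes less than 1/2 and the slacks
    together exactly 1/2.\<close>
  define \<epsilon> where "\<epsilon> = 1 / (2 * W 0 * ?h powr s')"
  have \<epsilon>: "0 < \<epsilon>" using Wpos[of 0] by (simp add: \<epsilon>_def)
  have "hausdorff_content ?d (lspace N) s 1 ?E \<le> hausdorff_measure ?d (lspace N) s ?E"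
    unfolding hausdorff_measure_def by (intro SUP_upper) simp
  then have "hausdorff_content ?d (lspace N) s 1 ?E < ennreal \<epsilon>"
    using zero \<epsilon> by simp
  then obtain U where cover: "?E \<subseteq> (\<Union>j. U j)"
    and bdd: "\<And>j. mbounded ?d (U j)" and diam: "\<And>j. mdiam ?d (U j) \<le> 1"
    and total: "(\<Sum>j. ennreal (diam_pow ?d s (U j))) < ennreal \<epsilon>"
    unfolding hausdorff_content_def INF_less_iff by blast
  define e where "e j = (1 / 2) ^ Suc j / (2 * W 0)" for j :: nat
  have e: "0 < e j" for j using Wpos[of 0] by (simp add: e_def)
  have "\<forall>j. \<exists>t::nat. (\<forall>x\<in>U j. \<forall>y\<in>U j. \<forall>r<N. vanishes_below (int t) (x r - y r)) \<and>
      ?h powr (- (real t * s')) \<le> ?h powr s' * diam_pow ?d s (U j) + e j"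
    using ex_scale[OF bdd diam s(1) s' e] by blast
  then obtain t :: "nat \<Rightarrow> nat" where
    close: "\<And>j. \<forall>x\<in>U j. \<forall>y\<in>U j. \<forall>r<N. vanishes_below (int (t j)) (x r - y r)" and
    t: "\<And>j. ?h powr (- (real (t j) * s')) \<le> ?h powr s' * diam_pow ?d s (U j) + e j"
    by metis
  \<comment> \<open>The least level with \<open>T\<close> > \<open>t j\<close>: its boxes have all
    sides below h^(-\<open>t j\<close>), while at most \<open>t j / k\<close> halvings have taken
    place.\<close>
  define lev where "lev j = t j div k" for j
  have tT: "t j \<le> T (lev j)" for j
    using dividend_less_div_times[of k "t j"] k(1) by (simp add: T_def lev_def)
  define C where "C j = (\<lambda>y. restrict (\<lambda>(r, l). y r $$ int l) (D (lev j))) ` U j" for j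
  have C: "C j \<subseteq> D (lev j) \<rightarrow>\<^sub>E UNIV" for j by (auto simp: C_def)
  have weight: "real (card (C j)) * W 0 / W (lev j)
      \<le> W 0 * (?h powr s' * diam_pow ?d s (U j) + e j)" for j
  proof -
    have cardD: "N * t j \<le> card (D (lev j))"
    proof -
      have "card ({..<N} \<times> {..<t j}) \<le> card (D (lev j))"
        using tT[of j] by (intro card_mono finD) (auto simp: D_def box_indices_def)
      then show ?thesis by (simp add: card_cartesian_product)
    qed
    have "card (C j) \<le> CARD('a) ^ (card (D (lev j)) - N * t j)"
      unfolding C_def D_def using tT[of j] by (intro card_restrictions_le close) simp
    then have "real (card (C j)) \<le> real (CARD('a) ^ (card (D (lev j)) - N * t j))"
      by (rule of_nat_mono)
    also have "\<dots> = ?h ^ card (D (lev j)) / ?h ^ (N * t j)"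
      unfolding of_nat_power using cardD h by (intro power_diff) auto
    finally have "real (card (C j)) * W 0 / W (lev j)
        \<le> ?h ^ card (D (lev j)) / ?h ^ (N * t j) * W 0 / W (lev j)"
      using Wpos[of 0] Wpos[of "lev j"] by (intro divide_right_mono mult_right_mono) auto
    also have "\<dots> = W 0 * (2 ^ lev j / ?h ^ (N * t j))"
      using h by (simp add: W_def field_simps)
    also have "\<dots> \<le> W 0 * ?h powr (- (real (t j) * s'))"
    proof (rule mult_left_mono)
      \<comment> \<open>This is where N - 1/k comes from: 2 \<le> h bounds the halvings by h^(t/k),
        against the factor h^(-N t) from the coefficients shared by the points of
        \<open>U j\<close>.\<close>
      have "(2::real) ^ lev j \<le> ?h ^ lev j" using h by (intro power_mono) auto
      also have "\<dots> = ?h powr real (lev j)" using h by (simp add: powr_realpow)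
      also have "\<dots> \<le> ?h powr (real (t j) / real k)"
        using h by (intro powr_mono) (auto simp: lev_def of_nat_div_le_of_nat)
      finally have "2 ^ lev j / ?h ^ (N * t j) \<le> ?h powr (real (t j) / real k) / ?h powr real (N * t j)"
        using h by (simp add: powr_realpow[symmetric] divide_right_mono)
      also have "\<dots> = ?h powr (real (t j) / real k - real (N * t j))"
        using h by (simp add: powr_diff)
      also have "real (t j) / real k - real (N * t j) = - (real (t j) * s')"
        by (simp add: s'_def algebra_simps)
      finally show "2 ^ lev j / ?h ^ (N * t j) \<le> ?h powr (- (real (t j) * s'))" .
    qed (use Wpos[of 0] in simp)
    also have "\<dots> \<le> W 0 * (?h powr s' * diam_pow ?d s (U j) + e j)"
      using Wpos[of 0] by (intro mult_left_mono t) simp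
    finally show ?thesis .
  qed
  have small: "(\<Sum>j. ennreal (real (card (C j)) * W 0 / W (lev j))) < 1"
  proof -
    let ?c = "W 0 * ?h powr s'"
    have c: "0 < ?c" using Wpos[of 0] by simp
    have dp0: "0 \<le> diam_pow ?d s (U j)" for j by (simp add: diam_pow_def)
    have "ennreal (real (card (C j)) * W 0 / W (lev j))
        \<le> ennreal ?c * ennreal (diam_pow ?d s (U j)) + ennreal ((1 / 2) ^ Suc j / 2)" for j
    proof -
      have "W 0 * (?h powr s' * diam_pow ?d s (U j) + e j)
          = ?c * diam_pow ?d s (U j) + (1 / 2) ^ Suc j / 2"
        using Wpos[of 0] by (simp add: e_def field_simps)
      with weight[of j] have "ennreal (real (card (C j)) * W 0 / W (lev j))
          \<le> ennreal (?c * diam_pow ?d s (U j) + (1 / 2) ^ Suc j / 2)"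
        by (intro ennreal_leI) linarith
      also have "\<dots> = ennreal ?c * ennreal (diam_pow ?d s (U j)) + ennreal ((1 / 2) ^ Suc j / 2)"
        using c dp0[of j] by (subst ennreal_plus) (auto simp: ennreal_mult)
      finally show ?thesis .
    qed
    then have "(\<Sum>j. ennreal (real (card (C j)) * W 0 / W (lev j)))
        \<le> (\<Sum>j. ennreal ?c * ennreal (diam_pow ?d s (U j)) + ennreal ((1 / 2) ^ Suc j / 2))"
      by (intro suminf_le) auto
    also have "\<dots> = ennreal ?c * (\<Sum>j. ennreal (diam_pow ?d s (U j)))
        + (\<Sum>j. ennreal ((1 / 2) ^ Suc j / 2))"
      by (subst suminf_add[symmetric]) auto
    also have "(\<Sum>j. ennreal ((1 / 2) ^ Suc j / 2)) = ennreal (1 / 2)"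
      using sums_divide[OF power_half_series, of 2] by (intro suminf_ennreal_eq) auto
    also have "ennreal ?c * (\<Sum>j. ennreal (diam_pow ?d s (U j))) + ennreal (1 / 2)
        < ennreal ?c * ennreal \<epsilon> + ennreal (1 / 2)"
    proof -
      have "ennreal ?c * (\<Sum>j. ennreal (diam_pow ?d s (U j))) < ennreal ?c * ennreal \<epsilon>"
        using c by (intro ennreal_mult_strict_left_mono total) simp_all
      then show ?thesis by (simp add: add.commute[of _ "ennreal (1 / 2)"] ennreal_add_left_cancel_less)
    qed
    also have "\<dots> = ennreal (?c * \<epsilon> + 1 / 2)"
      using c \<epsilon> by (subst ennreal_plus) (auto simp: ennreal_mult)
    also have "?c * \<epsilon> + 1 / 2 = 1" using Wpos[of 0] by (simp add: \<epsilon>_def)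
    finally show ?thesis by simp
  qed

  obtain w where w: "\<And>J. good J (restrict w (D (Suc J)))" "\<And>j. restrict w (D (lev j)) \<notin> C j"
    using ex_good_path_avoiding[where D = D and good = good and C = C and lev = lev,
        OF finD mono half C small[unfolded W_def]]
    by blast
  let ?y = "fls_point N w"
  \<comment> \<open>The limit point agrees with its own node at level \<open>Suc J\<close>, so if it
    were approximable it would itself witness that the node is not good.\<close>
  have "\<not> approximable S (\<alpha> J) k (T J) ?y" for J
  proof -
    have "vanishes_below (int (T J + \<alpha> J r + 1)) (?y r - fls_point N (restrict w (D (Suc J))) r)"
      if "r \<in> S" for r
    proof (rule vanishes_below_fls_point_diff)
      show "r < N" using that SN by auto
      fix l assume "l < T J + \<alpha> J r + 1"
      then have "(r, l) \<in> D (Suc J)"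
        using L[OF \<open>r < N\<close>, of J] \<open>r < N\<close> by (simp add: D_def box_indices_def)
      then show "w (r, l) = restrict w (D (Suc J)) (r, l)" by simp
    qed
    then show ?thesis using w(1)[of J] unfolding good_def by blast
  qed
  then have "?y \<in> ?E"
    using k(1) Sne unfolding S_def \<alpha>_def T_def
    by (intro Bad_if_not_approximable[OF nonneg, where k = k] fls_point_in_lspace) auto
  with cover obtain j where j: "?y \<in> U j" by blast
  have eq: "restrict (\<lambda>(r, l). ?y r $$ int l) (D (lev j)) = restrict w (D (lev j))"
    by (auto simp: fun_eq_iff D_def box_indices_def fls_point_nth)
  have "restrict w (D (lev j)) \<in> C j"
    unfolding C_def by (rule image_eqI[where x = ?y]) (rule eq[symmetric], rule j)
  with w(2) show False by blast
qed

section \<open>The upper bound for the dimension\<close>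

text \<open>The whole space is unbounded, so it is exhausted by balls of radius h^n. The n-th is cut
  into h^(N(n+t)) balls of radius h^(-t), and since s > N, a large t = \<open>t n\<close> brings its
  share below \<epsilon> / 2^(n+1).\<close>

lemma hausdorff_measure_lspace_subset_zero:
  fixes E :: "(nat \<Rightarrow> 'a::{field,finite} fls) set"
  assumes s: "real N < s" and E: "E \<subseteq> lspace N"
  shows "hausdorff_measure (ldist N) (lspace N) s E = 0"
proof -
  let ?d = "ldist N :: (nat \<Rightarrow> 'a fls) \<Rightarrow> _"
  let ?h = "real CARD('a)"
  have h: "1 < ?h" using card_field_ge_2[where 'a='a] by simp
  have content: "hausdorff_content ?d (lspace N) s \<delta> E \<le> ennreal \<epsilon>" if \<delta>: "0 < \<delta>" and \<epsilon>: "0 < \<epsilon>" for \<delta> \<epsilon> :: real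
  proof -
    have "\<exists>t. ?h powr (- real t) \<le> \<delta> \<and>
        ?h ^ (N * (n + t)) * ?h powr (- (real t * s)) \<le> \<epsilon> * (1 / 2) ^ Suc n" for n
    proof -
      have e: "0 < \<epsilon> * (1 / 2) ^ Suc n / ?h ^ (N * n)" using \<epsilon> h by simp
      obtain t1 where t1: "\<And>t. t \<ge> t1 \<Longrightarrow> ?h powr (- (real t * 1)) \<le> \<delta>"
        using ex_powr_minus_le[OF h _ \<delta>, of 1] by auto
      obtain t2 where t2: "\<And>t. t \<ge> t2 \<Longrightarrow>
          ?h powr (- (real t * (s - real N))) \<le> \<epsilon> * (1 / 2) ^ Suc n / ?h ^ (N * n)"
        using ex_powr_minus_le[OF h _ e, of "s - real N"] s by auto
      let ?t = "max t1 t2"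
      have "?h ^ (N * (n + ?t)) * ?h powr (- (real ?t * s))
          = ?h ^ (N * n) * (?h powr real (N * ?t) * ?h powr (- (real ?t * s)))"
        using h by (subst powr_realpow) (auto simp: power_add algebra_simps)
      also have "?h powr real (N * ?t) * ?h powr (- (real ?t * s)) = ?h powr (- (real ?t * (s - real N)))"
        by (simp add: powr_add[symmetric] algebra_simps)
      also have "?h ^ (N * n) * \<dots> \<le> ?h ^ (N * n) * (\<epsilon> * (1 / 2) ^ Suc n / ?h ^ (N * n))"
        by (intro mult_left_mono t2) auto
      also have "\<dots> = \<epsilon> * (1 / 2) ^ Suc n" using h by simp
      finally show ?thesis using t1[of ?t] by (intro exI[of _ ?t]) simp
    qed
    then obtain t where t: "\<And>n. ?h powr (- real (t n)) \<le> \<delta>"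
      "\<And>n. ?h ^ (N * (n + t n)) * ?h powr (- (real (t n) * s)) \<le> \<epsilon> * (1 / 2) ^ Suc n"
      by metis
    define A where "A n = ({..<N} \<times> {..<n + t n}) \<rightarrow>\<^sub>E (UNIV :: 'a set)" for n
    have finA: "finite (A n)" for n unfolding A_def by (intro finite_PiE) auto
    have cardA: "card (A n) = CARD('a) ^ (N * (n + t n))" for n
      by (simp add: A_def card_PiE card_cartesian_product)
    define V where "V n c = {x \<in> lspace N. \<forall>r<N. \<forall>l. l < int (t n) \<longrightarrow>
        x r $$ l = (if l < - int n then 0 else c (r, nat (l + int n)))}" for n and c :: "nat \<times> nat \<Rightarrow> 'a"
    have dist_V: "?d x y \<le> ?h powr (- real (t n))" if "x \<in> V n c" "y \<in> V n c" for n c x y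
    proof (rule ldist_le)
      fix r assume "r < N"
      then have "vanishes_below (int (t n)) (x r - y r)"
        using that by (simp add: V_def vanishes_below_def)
      then show "lnorm (x r - y r) \<le> ?h powr (- real (t n))"
        by (simp add: lnorm_le_iff_vanishes_below[symmetric])
    qed simp
    have "\<forall>n. \<exists>b. bij_betw b {0..<card (A n)} (A n)"
      using ex_bij_betw_nat_finite[OF finA] by blast
    then obtain b where b: "\<And>n. bij_betw (b n) {0..<card (A n)} (A n)" by metis
    \<comment> \<open>The pieces are enumerated by pairs of naturals. Positions beyond the number of
      pieces hold the empty set, on which \<open>diam_pow\<close> is 0.\<close>
    define V' where "V' = (\<lambda>(n, m). if m < card (A n) then V n (b n m) else {})"
    define U where "U j = V' (prod_decode j)" for j
    have dist_V': "?d x y \<le> ?h powr (- real (t n))" if "x \<in> V' (n, m)" "y \<in> V' (n, m)" for n m x y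
      using that dist_V[of x n "b n m" y] by (auto simp: V'_def split: if_splits)
    have mdiam_V': "mdiam ?d (V' (n, m)) \<le> ?h powr (- real (t n))" for n m
      by (rule mdiam_le) (auto intro: dist_V')
    have bdd_V': "mbounded ?d (V' (n, m))" for n m
      unfolding mbounded_def using dist_V' by blast
    have U: "U j \<subseteq> lspace N \<and> mbounded ?d (U j) \<and> mdiam ?d (U j) \<le> \<delta>" for j
    proof -
      obtain n m where "prod_decode j = (n, m)" by fastforce
      moreover have "V' (n, m) \<subseteq> lspace N" by (auto simp: V'_def V_def)
      ultimately show ?thesis using bdd_V' mdiam_V'[of n m] t(1)[of n] by (auto simp: U_def)
    qed
    have cover: "E \<subseteq> (\<Union>j. U j)"
    proof
      fix x assume "x \<in> E"
      then have x: "x \<in> lspace N" using E by blast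
      define n where "n = Max (insert 0 ((\<lambda>r. nat (- fls_subdegree (x r))) ` {..<N}))"
      have n: "nat (- fls_subdegree (x r)) \<le> n" if "r < N" for r
        unfolding n_def using that by (intro Max_ge) auto
      define c where "c = restrict (\<lambda>(r, m). x r $$ (int m - int n)) ({..<N} \<times> {..<n + t n})"
      have "x r $$ l = (if l < - int n then 0 else c (r, nat (l + int n)))"
        if "r < N" "l < int (t n)" for r l
        using n[OF that(1)] that by (auto simp: c_def)
      then have xV: "x \<in> V n c" using x by (simp add: V_def)
      have "c \<in> A n" by (auto simp: A_def c_def)
      then have "c \<in> b n ` {0..<card (A n)}"
        using b[of n] by (simp add: bij_betw_def)
      then obtain m where m: "m < card (A n)" "b n m = c" by auto
      have "x \<in> U (prod_encode (n, m))"
        using xV m by (simp add: U_def V'_def)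
      then show "x \<in> (\<Union>j. U j)" by blast
    qed
    have dp: "diam_pow ?d s (V' (n, m)) \<le> ?h powr (- (real (t n) * s))" for n m
    proof (cases "V' (n, m) = {}")
      case False
      have "mdiam ?d (V' (n, m)) powr s \<le> (?h powr (- real (t n))) powr s"
        using s mdiam_ldist_nonneg[OF bdd_V'] by (intro powr_mono2 mdiam_V') auto
      then show ?thesis using False s by (simp add: diam_pow_def powr_powr)
    qed (simp add: diam_pow_def)
    have dp_outside: "diam_pow ?d s (V' (n, m)) = 0" if "\<not> m < card (A n)" for n m
      using that by (simp add: V'_def diam_pow_def)
    have "(\<Sum>j. ennreal (diam_pow ?d s (U j)))
        = (\<Sum>n. \<Sum>m. ennreal (diam_pow ?d s (V' (n, m))))"
      unfolding U_def by (rule suminf_ennreal_2dimen) simp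
    also have "\<dots> \<le> (\<Sum>n. ennreal (\<epsilon> * (1 / 2) ^ Suc n))"
    proof (intro suminf_le)
      fix n
      have "(\<Sum>m. ennreal (diam_pow ?d s (V' (n, m))))
          = (\<Sum>m<card (A n). ennreal (diam_pow ?d s (V' (n, m))))"
        by (rule suminf_finite) (auto simp: dp_outside)
      also have "\<dots> \<le> (\<Sum>m<card (A n). ennreal (?h powr (- (real (t n) * s))))"
        by (intro sum_mono ennreal_leI dp)
      also have "\<dots> = ennreal (\<Sum>m<card (A n). ?h powr (- (real (t n) * s)))"
        by (rule sum_ennreal) simp
      also have "(\<Sum>m<card (A n). ?h powr (- (real (t n) * s)))
          = ?h ^ (N * (n + t n)) * ?h powr (- (real (t n) * s))"
        by (simp add: cardA)
      also have "ennreal \<dots> \<le> ennreal (\<epsilon> * (1 / 2) ^ Suc n)"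
        by (intro ennreal_leI t(2))
      finally show "(\<Sum>m. ennreal (diam_pow ?d s (V' (n, m)))) \<le> ennreal (\<epsilon> * (1 / 2) ^ Suc n)" .
    qed auto
    also have "\<dots> = ennreal \<epsilon>"
      using sums_mult[OF power_half_series, of \<epsilon>] \<epsilon> by (intro suminf_ennreal_eq) auto
    finally have sum_le: "(\<Sum>j. ennreal (diam_pow ?d s (U j))) \<le> ennreal \<epsilon>" .
    show ?thesis
      unfolding hausdorff_content_def using cover U sum_le by (intro INF_lower2[of U]) auto
  qed
  have "hausdorff_content ?d (lspace N) s \<delta> E \<le> 0" if "0 < \<delta>" for \<delta>
    by (rule ennreal_le_epsilon) (use content[OF that] in simp)
  then have "hausdorff_measure ?d (lspace N) s E \<le> 0"
    unfolding hausdorff_measure_def by (intro SUP_least) simp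
  then show ?thesis by simp
qed

theorem theorem11:
  fixes N :: nat and i :: "nat \<Rightarrow> real"
  assumes "\<forall>s<N. i s \<ge> 0"
    and "(\<Sum>s<N. i s) = 1"
  shows "hausdorff_dim (ldist N) (lspace N) (Bad N i :: (nat \<Rightarrow> 'a::{field,finite} fls) set)
           = real N"
proof -
  define X where "X = {s. 0 \<le> s \<and> hausdorff_measure (ldist N) (lspace N) s
    (Bad N i :: (nat \<Rightarrow> 'a::{field,finite} fls) set) = 0}"
  have "Bad N i \<subseteq> (lspace N :: (nat \<Rightarrow> 'a fls) set)" by (auto simp: Bad_def)
  then have above: "s \<in> X" if "real N < s" for s
    using that hausdorff_measure_lspace_subset_zero[of N s "Bad N i :: (nat \<Rightarrow> 'a fls) set"]
    by (simp add: X_def)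
  have below: "real N \<le> s" if "s \<in> X" for s
    using that hausdorff_measure_Bad_nonzero[OF assms, of s, where 'a = 'a]
    by (force simp: X_def)
  \<comment> \<open>Whether N itself lies in \<open>X\<close> is left open, so the infimum is
    approached from above.\<close>
  have "Inf X \<le> real N"
  proof (rule field_le_epsilon)
    fix e :: real assume "0 < e"
    then have "real N + e \<in> X" by (intro above) simp
    then show "Inf X \<le> real N + e"
      by (rule cInf_lower) (rule bdd_belowI, rule below)
  qed
  moreover have "real N \<le> Inf X"
  proof (rule cInf_greatest)
    have "real N + 1 \<in> X" by (rule above) simp
    then show "X \<noteq> {}" by blast
  qed (rule below)
  ultimately show ?thesis unfolding hausdorff_dim_def X_def by (rule antisym)
qed

end
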